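(* Let $\alpha>0.5$ and consider the QCARE policy with parameter $\alpha$. Even when $N=2$, there exists an instance $\Theta$ (not depending on $T$) under which an $\Omega(T)$ regret is incurred with probability $\Omega(T^{-o(1)})$; that is, there is a constant $c>0$ such that $$\Pr\Big(\sum_{t=1}^T(\mu^*-\mu_{a(t)})\ge cT\Big)=\Omega(T^{-o(1)})\quad\text{as }T\to\infty .$$ Therefore the worst-case regret of QCARE satisfies $$\mathcal R(T)=\Omega(T^{1-\varepsilon})\quad\text{for every }\varepsilon>0 .$$
   Context: Bandit problem. There are $N$ arms, $[N]=\{1,\dots,N\}$ (here $N=2$). Each arm $i$ has an i.i.d. reward sequence $\{r_i(t)\}_{t\ge1}$ drawn from a fixed distribution supported on $[0,1]$ with mean $\mu_i$; the collection of reward distributions is the instance $\Theta$. The optimal arm $i^*=\arg\max_i\mu_i$ is assumed unique, and $\mu^*=\max_i\mu_i$. At each time $t=1,2,\dots$ an action $a(t)\in[N]$ is chosen and the reward $r_{a(t)}(t)$ is observed; conditionally on the past and on $a(t)=i$, this reward has arm $i$'s distribution. The regret on instance $\Theta$ is $\mathcal R^\Theta(T)=\mu^*T-\mathbb E\big[\sum_{t=1}^T r_{a(t)}(t)\big]=\mathbb E\big[\sum_{t=1}^T(\mu^*-\mu_{a(t)})\big]$ and the worst-case regret is $\mathcal R(T)=\sup_\Theta\mathcal R^\Theta(T)$, the supremum being over all $N$-armed instances, separately for each $T$. QCARE. Let $k_i(t)=\sum_{\ell=1}^{t-1}\mathbb I\{a(\ell)=i\}$ and $\hat\mu_i(t)=\frac{1}{k_i(t)+1}\sum_{\ell\le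 t-1:\,a(\ell)=i} r_i(\ell)$. The QCARE policy with parameter $\alpha$ plays at each time $t$ the arm $a(t)=\arg\max_i\theta_i(t)$, where $\theta_i(t)=\hat\mu_i(t)+\frac{\epsilon_{it}}{(k_i(t)+1)^\alpha}$ and the $\epsilon_{it}$ are independent standard normal random variables (independent of the rewards). Notation: $f(T)=\Omega(g(T))$ means $\liminf_{T\to\infty}f(T)/g(T)>0$; $f(T)=\Omega(T^{-o(1)})$ means that $f(T)=\Omega(T^{-\eta_T})$ for some sequence $\eta_T\to0$. *)

theory Defs
  imports "HOL-Probability.Probability"
begin

text \<open>The arms are \<open>1, \<dots>, N\<close>, and an instance assigns to each arm its reward distribution; the
  values of \<open>\<Theta>\<close> at other indices are irrelevant.\<close>

definition arm_mean :: "(nat \<Rightarrow> real measure) \<Rightarrow> nat \<Rightarrow> real" where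
  "arm_mean \<Theta> i = (\<integral>x. x \<partial>\<Theta> i)"

definition best_mean :: "nat \<Rightarrow> (nat \<Rightarrow> real measure) \<Rightarrow> real" where
  "best_mean N \<Theta> = Max (arm_mean \<Theta> ` {1..N})"

definition bandit_instance :: "nat \<Rightarrow> (nat \<Rightarrow> real measure) \<Rightarrow> bool" where
  "bandit_instance N \<Theta> \<longleftrightarrow>
     (\<forall>i\<in>{1..N}. prob_space (\<Theta> i) \<and> sets (\<Theta> i) = sets borel \<and> (AE x in \<Theta> i. x \<in> {0..1})) \<and>
     (\<exists>!i. i \<in> {1..N} \<and> arm_mean \<Theta> i = best_mean N \<Theta>)"

text \<open>Below, \<open>a t\<close> is the arm played at time \<open>t\<close>, and \<open>r (i, t)\<close>, \<open>e (i, t)\<close> are the reward of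
  arm \<open>i\<close> and the noise for arm \<open>i\<close> at time \<open>t\<close>. Times start at 1.\<close>

definition pulls :: "(nat \<Rightarrow> nat) \<Rightarrow> nat \<Rightarrow> nat \<Rightarrow> nat" where
  "pulls a i t = card {l \<in> {1..<t}. a l = i}"

definition emp_mean :: "(nat \<Rightarrow> nat) \<Rightarrow> (nat \<times> nat \<Rightarrow> real) \<Rightarrow> nat \<Rightarrow> nat \<Rightarrow> real" where
  "emp_mean a r i t = (\<Sum>l | l \<in> {1..<t} \<and> a l = i. r (i, l)) / (real (pulls a i t) + 1)"

definition qcare_index ::
  "real \<Rightarrow> (nat \<Rightarrow> nat) \<Rightarrow> (nat \<times> nat \<Rightarrow> real) \<Rightarrow> (nat \<times> nat \<Rightarrow> real) \<Rightarrow> nat \<Rightarrow> nat \<Rightarrow> real" where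
  "qcare_index \<alpha> a r e i t = emp_mean a r i t + e (i, t) / (real (pulls a i t) + 1) powr \<alpha>"

definition argmax_arm :: "nat \<Rightarrow> (nat \<Rightarrow> real) \<Rightarrow> nat" where
  "argmax_arm N \<theta> = (LEAST i. i \<in> {1..N} \<and> (\<forall>j\<in>{1..N}. \<theta> j \<le> \<theta> i))"

text \<open>Ties are broken towards the smaller arm; under continuous noise they have probability 0.
  The index at time \<open>t\<close> only looks at the actions before \<open>t\<close>, so truncating the action sequence at
  \<open>t\<close>, which makes the recursion well founded, changes nothing: see \<open>qcare_action_eq\<close>.\<close>

fun qcare_action ::
  "nat \<Rightarrow> real \<Rightarrow> (nat \<times> nat \<Rightarrow> real) \<Rightarrow> (nat \<times> nat \<Rightarrow> real) \<Rightarrow> nat \<Rightarrow> nat" where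
  "qcare_action N \<alpha> r e t =
     argmax_arm N (\<lambda>i. qcare_index \<alpha> (\<lambda>l. if l < t then qcare_action N \<alpha> r e l else 0) r e i t)"

declare qcare_action.simps [simp del]

lemma qcare_index_cong:
  assumes "\<And>l. l < t \<Longrightarrow> a l = b l"
  shows "qcare_index \<alpha> a r e i t = qcare_index \<alpha> b r e i t"
proof -
  have *: "{l \<in> {1..<t}. a l = i} = {l \<in> {1..<t}. b l = i}"
    using assms by auto
  show ?thesis
    unfolding qcare_index_def emp_mean_def pulls_def * ..
qed

lemma qcare_action_eq:
  "qcare_action N \<alpha> r e t =
     argmax_arm N (\<lambda>i. qcare_index \<alpha> (qcare_action N \<alpha> r e) r e i t)"
proof -
  have "qcare_index \<alpha> (\<lambda>l. if l < t then qcare_action N \<alpha> r e l else 0) r e i t =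
        qcare_index \<alpha> (qcare_action N \<alpha> r e) r e i t" for i
    by (rule qcare_index_cong) simp
  then show ?thesis
    by (subst qcare_action.simps) simp
qed

lemma argmax_arm:
  assumes "N \<ge> 1"
  shows "argmax_arm N \<theta> \<in> {1..N}" and "j \<in> {1..N} \<Longrightarrow> \<theta> j \<le> \<theta> (argmax_arm N \<theta>)"
proof -
  have "finite (\<theta> ` {1..N})" "\<theta> ` {1..N} \<noteq> {}"
    using assms by auto
  from Max_in[OF this] obtain i where i: "i \<in> {1..N}" "Max (\<theta> ` {1..N}) = \<theta> i"
    by auto
  have "\<forall>j\<in>{1..N}. \<theta> j \<le> \<theta> i"
    using \<open>finite (\<theta> ` {1..N})\<close> by (simp flip: i(2))
  with i(1) have "\<exists>i. i \<in> {1..N} \<and> (\<forall>j\<in>{1..N}. \<theta> j \<le> \<theta> i)"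
    by blast
  from LeastI_ex[OF this, folded argmax_arm_def]
  show "argmax_arm N \<theta> \<in> {1..N}" and "j \<in> {1..N} \<Longrightarrow> \<theta> j \<le> \<theta> (argmax_arm N \<theta>)"
    by blast+
qed

text \<open>A sample point \<open>(r, e)\<close> consists of the full reward and noise tables; all entries are
  independent.\<close>

definition bandit_space ::
  "nat \<Rightarrow> (nat \<Rightarrow> real measure) \<Rightarrow> ((nat \<times> nat \<Rightarrow> real) \<times> (nat \<times> nat \<Rightarrow> real)) measure" where
  "bandit_space N \<Theta> =
     (\<Pi>\<^sub>M (i, t)\<in>{1..N} \<times> {1..}. \<Theta> i) \<Otimes>\<^sub>M
     (\<Pi>\<^sub>M (i, t)\<in>{1..N} \<times> {1..}. density lborel std_normal_density)"

definition qcare_arm ::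
  "nat \<Rightarrow> real \<Rightarrow> (nat \<times> nat \<Rightarrow> real) \<times> (nat \<times> nat \<Rightarrow> real) \<Rightarrow> nat \<Rightarrow> nat" where
  "qcare_arm N \<alpha> \<omega> t = qcare_action N \<alpha> (fst \<omega>) (snd \<omega>) t"

definition regret :: "nat \<Rightarrow> real \<Rightarrow> (nat \<Rightarrow> real measure) \<Rightarrow> nat \<Rightarrow> real" where
  "regret N \<alpha> \<Theta> T =
     best_mean N \<Theta> * real T
       - (\<integral>\<omega>. (\<Sum>t = 1..T. fst \<omega> (qcare_arm N \<alpha> \<omega> t, t)) \<partial>bandit_space N \<Theta>)"

definition worst_regret :: "nat \<Rightarrow> real \<Rightarrow> nat \<Rightarrow> real" where
  "worst_regret N \<alpha> T = (SUP \<Theta>\<in>{\<Theta>. bandit_instance N \<Theta>}. regret N \<alpha> \<Theta> T)"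

text \<open>The real-valued supremum is a genuine one: the regret is at most \<open>T\<close>.\<close>

lemma regret_le:
  assumes "bandit_instance N \<Theta>" and "N \<ge> 1"
  shows "regret N \<alpha> \<Theta> T \<le> real T"
proof -
  let ?I = "{1..N} \<times> {1::nat..}"
  define R where "R = (\<Pi>\<^sub>M (i, t)\<in>?I. \<Theta> i)"
  define E where "E = (\<Pi>\<^sub>M (i, t::nat)\<in>?I. density lborel std_normal_density)"
  have prob: "prob_space (\<Theta> i)" and sets: "sets (\<Theta> i) = sets borel"
    and AE: "AE x in \<Theta> i. x \<in> {0..1}" if "i \<in> {1..N}" for i
    using assms that by (auto simp: bandit_instance_def)
  have R: "prob_space R"
    unfolding R_def by (intro prob_space_PiM) (use prob in auto)
  have E: "prob_space E"
    unfolding E_def by (intro prob_space_PiM) (auto intro: prob_space_normal_density)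
  interpret R: prob_space R by (rule R)
  interpret E: prob_space E by (rule E)
  interpret RE: pair_sigma_finite R E ..
  have AE_R: "AE r in R. 0 \<le> r (i, t)" if "(i, t) \<in> ?I" for i t
    unfolding R_def
    by (rule AE_PiM_component[of ?I _ "(i, t)"]) (use that prob AE in \<open>auto elim: AE_mp\<close>)
  have "AE r in R. \<forall>p\<in>?I. 0 \<le> r p"
    using AE_R by (subst AE_ball_countable) auto
  then have "AE r in distr (R \<Otimes>\<^sub>M E) R fst. \<forall>p\<in>?I. 0 \<le> r p"
    by (simp only: E.distr_pair_fst)
  then have AE_pair: "AE \<omega> in R \<Otimes>\<^sub>M E. \<forall>p\<in>?I. 0 \<le> fst \<omega> p"
    by (rule AE_distrD[rotated]) simp
  have "0 \<le> (\<integral>\<omega>. (\<Sum>t = 1..T. fst \<omega> (qcare_arm N \<alpha> \<omega> t, t)) \<partial>(R \<Otimes>\<^sub>M E))"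
  proof (rule integral_nonneg_AE, rule AE_mp[OF AE_pair], intro AE_I2 impI sum_nonneg)
    fix \<omega> :: "(nat \<times> nat \<Rightarrow> real) \<times> (nat \<times> nat \<Rightarrow> real)" and t
    assume nonneg: "\<forall>p\<in>?I. 0 \<le> fst \<omega> p" and t: "t \<in> {1..T}"
    have "qcare_arm N \<alpha> \<omega> t \<in> {1..N}"
      unfolding qcare_arm_def by (subst qcare_action_eq) (rule argmax_arm(1)[OF assms(2)])
    with nonneg t show "0 \<le> fst \<omega> (qcare_arm N \<alpha> \<omega> t, t)"
      by auto
  qed
  moreover have "best_mean N \<Theta> \<le> 1"
    unfolding best_mean_def
  proof (subst Max_le_iff)
    show "\<forall>m\<in>arm_mean \<Theta> ` {1..N}. m \<le> 1"
    proof safe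
      fix i assume i: "i \<in> {1..N}"
      interpret prob_space "\<Theta> i" using prob[OF i] .
      have "integrable (\<Theta> i) (\<lambda>x. x)"
        using AE[OF i] sets[OF i]
        by (intro integrable_const_bound[of _ 1])
           (auto elim!: AE_mp simp: measurable_cong_sets[OF sets[OF i] refl])
      then have "(\<integral>x. x \<partial>\<Theta> i) \<le> (\<integral>x. 1 \<partial>\<Theta> i)"
        using AE[OF i] by (intro integral_mono_AE) (auto elim!: AE_mp)
      then show "arm_mean \<Theta> i \<le> 1"
        by (simp add: arm_mean_def prob_space)
    qed
  qed (use assms in auto)
  then have "best_mean N \<Theta> * real T \<le> real T"
    by (simp add: mult_left_le_one_le mult.commute mult_left_le)
  ultimately show ?thesis
    unfolding regret_def bandit_space_def R_def[symmetric] E_def[symmetric] by simp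
qed

lemma bdd_above_regret:
  assumes "N \<ge> 1"
  shows "bdd_above ((\<lambda>\<Theta>. regret N \<alpha> \<Theta> T) ` {\<Theta>. bandit_instance N \<Theta>})"
  using regret_le[OF _ assms] by (intro bdd_aboveI2) auto

definition asymp_Omega :: "(nat \<Rightarrow> real) \<Rightarrow> (nat \<Rightarrow> real) \<Rightarrow> bool" where
  "asymp_Omega f g \<longleftrightarrow> 0 < liminf (\<lambda>T. ereal (f T / g T))"

definition Omega_T_minus_o1 :: "(nat \<Rightarrow> real) \<Rightarrow> bool" where
  "Omega_T_minus_o1 f \<longleftrightarrow>
     (\<exists>\<eta>. \<eta> \<longlonglongrightarrow> 0 \<and> asymp_Omega f (\<lambda>T. real T powr (- \<eta> T)))"

end

theory Submission
  imports Defs "HOL-Real_Asymp.Real_Asymp"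
begin

text \<open>Take a fair Bernoulli arm 1 and a deterministic arm 2 with reward \<open>1 / 4\<close>. With probability
  exponentially small in \<open>K\<close>, the noise signs make the policy play arm 1 in the first \<open>K\<close> rounds, where all
  its rewards are 0, and arm 2 in the next \<open>K\<close> rounds. From then on the noise enters the indices with a
  factor at most \<open>(K + 1) powr (- \<alpha>)\<close>, so arm 1 can come back within \<open>T\<close> rounds only if some normal noise
  exceeds a constant times \<open>(K + 1) powr \<alpha>\<close>, which is unlikely as soon as \<open>K\<close> is of order
  \<open>(ln T) powr (1 / (2 * \<alpha>))\<close>. Since \<open>\<alpha> > 1 / 2\<close>, this is \<open>o (ln T)\<close>, and the trap costs only a factor
  \<open>T powr (- o 1)\<close>.\<close>

subsection \<open>Measurability and the regret as an expected sum of gaps\<close>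

text \<open>The set of rounds being counted depends on the sample point. With a fixed range of
  summation and indicators in the summands, measurability follows from that of the single actions;
  \<open>emp_mean_eq_sum\<close> serves the same end.\<close>

lemma pulls_eq_sum: "pulls a i t = (\<Sum>l = 1..<t. of_bool (a l = i))"
  by (simp add: pulls_def sum_of_bool_eq) (auto intro!: arg_cong[where f = card])

lemma emp_mean_eq_sum:
  "emp_mean a r i t = (\<Sum>l = 1..<t. of_bool (a l = i) * r (i, l)) / (real (pulls a i t) + 1)"
proof -
  have "(\<Sum>l | l \<in> {1..<t} \<and> a l = i. r (i, l)) = (\<Sum>l = 1..<t. of_bool (a l = i) * r (i, l))"
    by (intro sum.mono_neutral_cong_left) auto
  then show ?thesis
    by (simp add: emp_mean_def)
qed

lemma qcare_arm_eq:
  "qcare_arm N \<alpha> \<omega> t = argmax_arm N (\<lambda>i. qcare_index \<alpha> (qcare_arm N \<alpha> \<omega>) (fst \<omega>) (snd \<omega>) i t)"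
proof -
  have "qcare_arm N \<alpha> \<omega> = qcare_action N \<alpha> (fst \<omega>) (snd \<omega>)"
    by (simp add: qcare_arm_def fun_eq_iff)
  then show ?thesis
    using qcare_action_eq by simp
qed

lemma qcare_arm_in: "N \<ge> 1 \<Longrightarrow> qcare_arm N \<alpha> \<omega> t \<in> {1..N}"
  by (subst qcare_arm_eq) (rule argmax_arm(1))

lemma argmax_arm_2: "argmax_arm 2 \<theta> = (if \<theta> 2 \<le> \<theta> 1 then 1 else 2)"
proof -
  have I: "{1..2::nat} = {1, 2}"
    by auto
  show ?thesis
    unfolding I argmax_arm_def by (cases "\<theta> 2 \<le> \<theta> 1") (auto intro!: Least_equality)
qed

lemma measurable_reward:
  assumes "\<And>i. i \<in> {1..N} \<Longrightarrow> sets (\<Theta> i) = sets borel" "i \<in> {1..N}" "t \<ge> 1"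
  shows "(\<lambda>\<omega>. fst \<omega> (i, t)) \<in> borel_measurable (bandit_space N \<Theta>)"
proof -
  have "(\<lambda>r. r (i, t)) \<in> (\<Pi>\<^sub>M (i, t)\<in>{1..N} \<times> {1::nat..}. \<Theta> i) \<rightarrow>\<^sub>M \<Theta> i"
    using measurable_component_singleton[of "(i, t)" "{1..N} \<times> {1::nat..}" "\<lambda>(i, t). \<Theta> i"] assms
    by simp
  then have "(\<lambda>r. r (i, t)) \<in> borel_measurable (\<Pi>\<^sub>M (i, t)\<in>{1..N} \<times> {1::nat..}. \<Theta> i)"
    using assms by (simp cong: measurable_cong_sets)
  then show ?thesis
    unfolding bandit_space_def by (rule measurable_compose[OF measurable_fst])
qed

lemma measurable_noise:
  assumes "i \<in> {1..N}" "t \<ge> 1"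
  shows "(\<lambda>\<omega>. snd \<omega> (i, t)) \<in> borel_measurable (bandit_space N \<Theta>)"
proof -
  have "(\<lambda>r. r (i, t)) \<in> borel_measurable
          (\<Pi>\<^sub>M (i, t)\<in>{1..N} \<times> {1::nat..}. density lborel (\<lambda>x. ennreal (std_normal_density x)))"
    using measurable_component_singleton[of "(i, t)" "{1..N} \<times> {1::nat..}"
            "\<lambda>(i, t). density lborel (\<lambda>x. ennreal (std_normal_density x))"] assms
    by simp
  then show ?thesis
    unfolding bandit_space_def by (rule measurable_compose[OF measurable_snd])
qed

text \<open>Strong induction over time: the index at \<open>t\<close> is built from indicators of
  earlier actions, rewards of rounds before \<open>t\<close> and one noise entry, and
  \<open>argmax_arm\<close> is the least number satisfying a measurable predicate.\<close>

lemma measurable_qcare_arm: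
  assumes sets: "\<And>i. i \<in> {1..N} \<Longrightarrow> sets (\<Theta> i) = sets borel" and "t \<ge> 1"
  shows "(\<lambda>\<omega>. qcare_arm N \<alpha> \<omega> t) \<in> bandit_space N \<Theta> \<rightarrow>\<^sub>M count_space UNIV"
  using \<open>t \<ge> 1\<close>
proof (induction t rule: less_induct)
  case (less t)
  let ?P = "bandit_space N \<Theta>"
  have arm: "(\<lambda>\<omega>. qcare_arm N \<alpha> \<omega> l) \<in> ?P \<rightarrow>\<^sub>M count_space UNIV" if "l \<in> {1..<t}" for l
    using less.IH that by auto
  have index: "(\<lambda>\<omega>. qcare_index \<alpha> (qcare_arm N \<alpha> \<omega>) (fst \<omega>) (snd \<omega>) i t) \<in> borel_measurable ?P"
    if i: "i \<in> {1..N}" for i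
  proof -
    have [measurable]: "(\<lambda>\<omega>. of_bool (qcare_arm N \<alpha> \<omega> l = i) :: real) \<in> borel_measurable ?P"
      if "l \<in> {1..<t}" for l
      using measurable_compose[OF arm[OF that], of "\<lambda>a. of_bool (a = i) :: real" borel] by simp
    have [measurable]: "(\<lambda>\<omega>. real (pulls (qcare_arm N \<alpha> \<omega>) i t)) \<in> borel_measurable ?P"
      unfolding pulls_eq_sum of_nat_sum of_nat_of_bool by measurable
    have [measurable]: "(\<lambda>\<omega>. fst \<omega> (i, l)) \<in> borel_measurable ?P" if "l \<in> {1..<t}" for l
      using measurable_reward[OF sets i, where t = l] that by simp
    have [measurable]: "(\<lambda>\<omega>. snd \<omega> (i, t)) \<in> borel_measurable ?P"
      using measurable_noise[OF i less.prems] .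
    show ?thesis
      unfolding qcare_index_def emp_mean_eq_sum by measurable
  qed
  have "Measurable.pred ?P (\<lambda>\<omega>. i \<in> {1..N} \<and> (\<forall>j\<in>{1..N}.
      qcare_index \<alpha> (qcare_arm N \<alpha> \<omega>) (fst \<omega>) (snd \<omega>) j t
        \<le> qcare_index \<alpha> (qcare_arm N \<alpha> \<omega>) (fst \<omega>) (snd \<omega>) i t))" for i
  proof (cases "i \<in> {1..N}")
    case True
    have "Measurable.pred ?P (\<lambda>\<omega>. \<forall>j\<in>{1..N}.
        qcare_index \<alpha> (qcare_arm N \<alpha> \<omega>) (fst \<omega>) (snd \<omega>) j t
          \<le> qcare_index \<alpha> (qcare_arm N \<alpha> \<omega>) (fst \<omega>) (snd \<omega>) i t)"
      unfolding pred_def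
    proof (rule sets.sets_Collect_finite_All)
      fix j assume "j \<in> {1..N}"
      from borel_measurable_le[OF index[OF this] index[OF True]]
      show "{\<omega> \<in> space ?P. qcare_index \<alpha> (qcare_arm N \<alpha> \<omega>) (fst \<omega>) (snd \<omega>) j t
              \<le> qcare_index \<alpha> (qcare_arm N \<alpha> \<omega>) (fst \<omega>) (snd \<omega>) i t} \<in> sets ?P" .
    qed simp
    then show ?thesis
      by (simp only: True simp_thms)
  next
    \<comment> \<open>The tables carry entries only for genuine arms, so measurability of the index
      is available only there; for any other \<open>i\<close> the predicate is constantly
      false.\<close>
    case False
    show ?thesis
      unfolding False[THEN Eq_FalseI] simp_thms by (rule measurable_const) simp
  qed
  then show ?case
    by (subst qcare_arm_eq) (simp only: argmax_arm_def measurable_Least)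
qed

section \<open>Independence of an action from the rewards of its own round\<close>

lemma qcare_action_upd_reward:
  assumes "t \<le> s"
  shows "qcare_action N \<alpha> (r((i, s) := x)) e t = qcare_action N \<alpha> r e t"
  using assms
proof (induction t rule: less_induct)
  case (less t)
  let ?r = "r((i, s) := x)"
  \<comment> \<open>The index at \<open>t\<close> reads rewards of rounds strictly before
    \<open>t \<le> s\<close> only, so the altered entry \<open>(i, s)\<close> is never seen. The
    case \<open>s = t\<close> is the one that independence needs.\<close>
  have "qcare_index \<alpha> (qcare_action N \<alpha> ?r e) ?r e j t = qcare_index \<alpha> (qcare_action N \<alpha> r e) r e j t" for j
  proof -
    have "qcare_index \<alpha> (qcare_action N \<alpha> ?r e) ?r e j t = qcare_index \<alpha> (qcare_action N \<alpha> r e) ?r e j t"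
      using less.prems by (intro qcare_index_cong less.IH) auto
    also have "\<dots> = qcare_index \<alpha> (qcare_action N \<alpha> r e) r e j t"
    proof -
      have "emp_mean a ?r j t = emp_mean a r j t" for a
        unfolding emp_mean_def using less.prems by (intro arg_cong2[where f = "(/)"] sum.cong) auto
      then show ?thesis
        by (simp add: qcare_index_def)
    qed
    finally show ?thesis .
  qed
  then show ?case
    by (simp only: qcare_action_eq[of _ _ _ _ t])
qed

text \<open>A function that ignores coordinate \<open>p\<close> is independent of that coordinate:
  splitting off \<open>p\<close> turns the integrand into a product of functions of separate
  variables, and Fubini's theorem separates the integrals.\<close>

lemma integral_PiM_mult_component:
  fixes f g :: "_ \<Rightarrow> real"
  assumes M: "\<And>i. i \<in> I \<Longrightarrow> prob_space (M i)" and p: "p \<in> I"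
    and f: "integrable (M p) f"
    and g: "integrable (PiM I M) g"
    and indep: "\<And>x y. g (x(p := y)) = g x"
  shows "(\<integral>x. g x * f (x p) \<partial>PiM I M) = (\<integral>x. g x \<partial>PiM I M) * (\<integral>y. f y \<partial>M p)"
proof -
  interpret prob_space "PiM I M"
    by (rule prob_space_PiM) (rule M)
  define J where "J = I - {p}"
  have I: "I = insert p J" and pJ: "p \<notin> J"
    using p by (auto simp: J_def)
  interpret Mp: prob_space "M p"
    using M p by simp
  interpret PJ: prob_space "PiM J M"
    by (rule prob_space_PiM) (use M J_def in auto)
  interpret MJ: pair_sigma_finite "M p" "PiM J M" ..
  \<comment> \<open>The product over \<open>I\<close> is the image of a product of two spaces, under
    the map that writes \<open>y\<close> into coordinate \<open>p\<close>. By \<open>indep\<close>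
    this writing leaves \<open>g\<close> unchanged, so \<open>g\<close> can be evaluated on
    \<open>PiM J M\<close> directly.\<close>
  have distr: "distr (M p \<Otimes>\<^sub>M PiM J M) (PiM I M) (\<lambda>(y, x). x(p := y)) = PiM I M"
    unfolding I by (rule distr_pair_PiM_eq_PiM) (use M J_def p in auto)
  have meas: "(\<lambda>(y, x). x(p := y)) \<in> M p \<Otimes>\<^sub>M PiM J M \<rightarrow>\<^sub>M PiM I M"
    unfolding I by measurable
  have swap: "(\<integral>x. h x \<partial>PiM I M) = (\<integral>(y, x). h (x(p := y)) \<partial>(M p \<Otimes>\<^sub>M PiM J M))"
    if "h \<in> borel_measurable (PiM I M)" for h :: "_ \<Rightarrow> real"
    using integral_distr[OF meas that] by (simp add: distr[unfolded case_prod_unfold] case_prod_unfold)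
  have [measurable]: "f \<in> borel_measurable (M p)" "g \<in> borel_measurable (PiM I M)"
      "(\<lambda>x. x p) \<in> PiM I M \<rightarrow>\<^sub>M M p"
    using f g p by auto
  have g': "integrable (M p \<Otimes>\<^sub>M PiM J M) (\<lambda>(y, x). g x)"
    using integrable_distr[OF meas, of g] g by (simp add: distr[unfolded case_prod_unfold] case_prod_unfold indep)
  \<comment> \<open>Fubini gives this for almost every \<open>y\<close>; the statement does not
    mention \<open>y\<close>, so on a probability space it simply holds.\<close>
  then have gJ: "integrable (PiM J M) g"
    using MJ.AE_integrable_fst'[OF g'] by (simp add: Mp.AE_const)
  have int: "integrable (M p \<Otimes>\<^sub>M PiM J M) (\<lambda>(y, x). g x * f y)"
  proof (rule MJ.Fubini_integrable)
    show "(\<lambda>(y, x). g x * f y) \<in> borel_measurable (M p \<Otimes>\<^sub>M PiM J M)"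
      using gJ f by measurable
  qed (use gJ f in \<open>simp_all add: abs_mult\<close>)
  show ?thesis
    using MJ.integral_snd[OF int] MJ.integral_snd[OF g'] 
    by (simp add: swap indep Mp.prob_space case_prod_unfold )
qed


section \<open>Probability spaces and integrability of rewards\<close>

lemma measurable_of_bool_qcare_arm:
  assumes "\<And>i. i \<in> {1..N} \<Longrightarrow> sets (\<Theta> i) = sets borel" "t \<ge> 1"
  shows "(\<lambda>\<omega>. of_bool (qcare_arm N \<alpha> \<omega> t = i) :: real) \<in> borel_measurable (bandit_space N \<Theta>)"
  by (rule measurable_compose[OF measurable_qcare_arm[OF assms]]) auto

lemma prob_space_rewards:
  assumes "bandit_instance N \<Theta>"
  shows "prob_space (\<Pi>\<^sub>M (i, t)\<in>{1..N} \<times> {1::nat..}. \<Theta> i)"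
  by (rule prob_space_PiM) (use assms in \<open>auto simp: bandit_instance_def\<close>)

lemma prob_space_noise:
  "prob_space (\<Pi>\<^sub>M (i, t)\<in>{1..N} \<times> {1::nat..}. density lborel std_normal_density)"
  by (rule prob_space_PiM) (auto intro: prob_space_normal_density)

lemma prob_space_bandit_space:
  assumes "bandit_instance N \<Theta>"
  shows "prob_space (bandit_space N \<Theta>)"
proof -
  interpret R: prob_space "\<Pi>\<^sub>M (i, t)\<in>{1..N} \<times> {1::nat..}. \<Theta> i"
    by (rule prob_space_rewards) fact
  interpret E: prob_space "\<Pi>\<^sub>M (i, t)\<in>{1..N} \<times> {1::nat..}. density lborel (\<lambda>x. ennreal (std_normal_density x))"
    by (rule prob_space_noise)
  interpret RE: pair_prob_space "\<Pi>\<^sub>M (i, t)\<in>{1..N} \<times> {1::nat..}. \<Theta> i"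
    "\<Pi>\<^sub>M (i, t)\<in>{1..N} \<times> {1::nat..}. density lborel (\<lambda>x. ennreal (std_normal_density x))" ..
  show ?thesis
    unfolding bandit_space_def by (rule RE.prob_space_axioms)
qed

lemma integrable_arm:
  assumes "bandit_instance N \<Theta>" "i \<in> {1..N}"
  shows "integrable (\<Theta> i) (\<lambda>x. x)"
proof -
  have prob: "prob_space (\<Theta> i)" and sets: "sets (\<Theta> i) = sets borel"
    and AE: "AE x in \<Theta> i. x \<in> {0..1}"
    using assms by (auto simp: bandit_instance_def)
  interpret prob_space "\<Theta> i"
    by fact
  show ?thesis
    using AE sets by (intro integrable_const_bound[of _ 1])
      (auto elim!: AE_mp simp: measurable_cong_sets[OF sets refl])
qed

lemma integrable_reward:
  assumes "bandit_instance N \<Theta>" "i \<in> {1..N}" "t \<ge> 1"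
  shows "integrable (bandit_space N \<Theta>) (\<lambda>\<omega>. fst \<omega> (i, t))"
proof -
  let ?I = "{1..N} \<times> {1::nat..}"
  define R where "R = (\<Pi>\<^sub>M (i, t)\<in>?I. \<Theta> i)"
  define E where "E = (\<Pi>\<^sub>M (i, t::nat)\<in>?I. density lborel std_normal_density)"
  interpret E: prob_space E
    unfolding E_def by (rule prob_space_noise)
  have "(\<lambda>r. r (i, t)) \<in> R \<rightarrow>\<^sub>M \<Theta> i"
    using measurable_component_singleton[of "(i, t)" ?I "\<lambda>(i, t). \<Theta> i"] assms by (simp add: R_def)
  note meas = this
  have distr: "distr R (\<Theta> i) (\<lambda>r. r (i, t)) = \<Theta> i"
    unfolding R_def using distr_PiM_component[of ?I "\<lambda>(i, t). \<Theta> i" "(i, t)"] assms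
    by (auto simp: bandit_instance_def)
  have "integrable R (\<lambda>r. r (i, t))"
    by (rule integrable_distr[OF meas]) (simp add: distr integrable_arm[OF assms(1,2)])
  then have "integrable (distr (R \<Otimes>\<^sub>M E) R fst) (\<lambda>r. r (i, t))"
    by (simp only: E.distr_pair_fst)
  then show ?thesis
    unfolding bandit_space_def R_def[symmetric] E_def[symmetric]
    by (rule integrable_distr[OF measurable_fst])
qed

text \<open>The action at time \<open>t\<close> does not look at the rewards of time \<open>t\<close>, so it is independent of them.\<close>

lemma integral_of_bool_mult_reward:
  assumes inst: "bandit_instance N \<Theta>" and i: "i \<in> {1..N}" and t: "t \<ge> 1"
  shows "(\<integral>\<omega>. of_bool (qcare_arm N \<alpha> \<omega> t = i) * fst \<omega> (i, t) \<partial>bandit_space N \<Theta>) =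
    (\<integral>\<omega>. of_bool (qcare_arm N \<alpha> \<omega> t = i) * arm_mean \<Theta> i \<partial>bandit_space N \<Theta>)"
proof -
  let ?I = "{1..N} \<times> {1::nat..}"
  let ?g = "\<lambda>\<omega>. of_bool (qcare_arm N \<alpha> \<omega> t = i) :: real"
  define R where "R = (\<Pi>\<^sub>M (i, t)\<in>?I. \<Theta> i)"
  define E where "E = (\<Pi>\<^sub>M (i, t::nat)\<in>?I. density lborel std_normal_density)"
  have P: "bandit_space N \<Theta> = R \<Otimes>\<^sub>M E"
    unfolding bandit_space_def R_def E_def ..
  interpret R: prob_space R
    unfolding R_def by (rule prob_space_rewards) fact
  interpret E: prob_space E
    unfolding E_def by (rule prob_space_noise)
  interpret RE: pair_prob_space R E ..
  have sets: "sets (\<Theta> j) = sets borel" and prob: "prob_space (\<Theta> j)" if "j \<in> {1..N}" for j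
    using inst that by (auto simp: bandit_instance_def)
  have meas: "?g \<in> borel_measurable (R \<Otimes>\<^sub>M E)"
    unfolding P[symmetric] by (rule measurable_of_bool_qcare_arm[OF sets t])
  have int: "integrable (R \<Otimes>\<^sub>M E) (\<lambda>\<omega>. ?g \<omega> * fst \<omega> (i, t))"
  proof (rule Bochner_Integration.integrable_bound)
    show "integrable (R \<Otimes>\<^sub>M E) (\<lambda>\<omega>. fst \<omega> (i, t))"
      unfolding P[symmetric] by (rule integrable_reward[OF inst i t])
    then show "(\<lambda>\<omega>. ?g \<omega> * fst \<omega> (i, t)) \<in> borel_measurable (R \<Otimes>\<^sub>M E)"
      by (intro borel_measurable_times meas borel_measurable_integrable)
  qed auto
  have int': "integrable (R \<Otimes>\<^sub>M E) (\<lambda>\<omega>. ?g \<omega> * arm_mean \<Theta> i)"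
    using meas by (intro integrable_mult_left RE.integrable_const_bound[of _ 1]) auto
  \<comment> \<open>With the noise table frozen, the action at \<open>t\<close> is a function of the
    rewards that ignores coordinate \<open>(i, t)\<close>, so the product formula applies. Fubini
    then integrates over the noise.\<close>
  have inner: "(\<integral>r. ?g (r, e) * r (i, t) \<partial>R) = (\<integral>r. ?g (r, e) * arm_mean \<Theta> i \<partial>R)"
    if e: "e \<in> space E" for e
  proof -
    have "(\<integral>r. ?g (r, e) * r (i, t) \<partial>R) = (\<integral>r. ?g (r, e) \<partial>R) * (\<integral>x. x \<partial>\<Theta> i)"
      unfolding R_def
    proof (subst integral_PiM_mult_component[where f = "\<lambda>x. x" and p = "(i, t)"])
      show "integrable (\<Pi>\<^sub>M (i, t)\<in>?I. \<Theta> i) (\<lambda>r. ?g (r, e))"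
        unfolding R_def[symmetric] using meas e
        by (intro R.integrable_const_bound[of _ 1]) (auto intro: measurable_Pair2')
    qed (use i t prob integrable_arm[OF inst i] in
          \<open>auto simp: qcare_arm_def qcare_action_upd_reward\<close>)
    then show ?thesis
      by (simp add: arm_mean_def)
  qed
  have eq: "(\<integral>\<omega>. h \<omega> \<partial>(R \<Otimes>\<^sub>M E)) = (\<integral>e. (\<integral>r. h (r, e) \<partial>R) \<partial>E)"
    if "integrable (R \<Otimes>\<^sub>M E) h" for h :: "_ \<Rightarrow> real"
    using RE.integral_snd[of "\<lambda>r e. h (r, e)"] that by simp
  show ?thesis
    unfolding P eq[OF int] eq[OF int']
    by (rule Bochner_Integration.integral_cong[OF refl]) (use inner in simp)
qed

section \<open>Regret as the expectation of the summed gaps\<close>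

lemma integrable_arm_mean_qcare_arm:
  assumes inst: "bandit_instance N \<Theta>" and N: "N \<ge> 1" and t: "t \<ge> 1"
  shows "integrable (bandit_space N \<Theta>) (\<lambda>\<omega>. arm_mean \<Theta> (qcare_arm N \<alpha> \<omega> t))"
proof -
  interpret prob_space "bandit_space N \<Theta>"
    by (rule prob_space_bandit_space) fact
  have sets: "sets (\<Theta> i) = sets borel" if "i \<in> {1..N}" for i
    using inst that by (auto simp: bandit_instance_def)
  show ?thesis
  proof (rule integrable_const_bound[of _ "\<Sum>i = 1..N. \<bar>arm_mean \<Theta> i\<bar>"])
    show "AE \<omega> in bandit_space N \<Theta>. norm (arm_mean \<Theta> (qcare_arm N \<alpha> \<omega> t)) \<le> (\<Sum>i = 1..N. \<bar>arm_mean \<Theta> i\<bar>)"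
      using qcare_arm_in[OF N] by (intro AE_I2) (auto intro!: member_le_sum)
    show "(\<lambda>\<omega>. arm_mean \<Theta> (qcare_arm N \<alpha> \<omega> t)) \<in> borel_measurable (bandit_space N \<Theta>)"
      by (rule measurable_compose[OF measurable_qcare_arm[OF sets t]]) auto
  qed
qed

text \<open>Splitting each reward according to the arm played reduces the claim to a single arm and
  round, where the reward may be replaced by its mean because the action is independent of it. The
  resulting summands are nonnegative, unlike differences of the best mean and realised
  rewards.\<close>

lemma regret_eq_expected_gaps:
  assumes inst: "bandit_instance N \<Theta>" and N: "N \<ge> 1"
  shows "regret N \<alpha> \<Theta> T =
    (\<integral>\<omega>. (\<Sum>t = 1..T. best_mean N \<Theta> - arm_mean \<Theta> (qcare_arm N \<alpha> \<omega> t)) \<partial>bandit_space N \<Theta>)"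
proof -
  let ?P = "bandit_space N \<Theta>"
  interpret prob_space ?P
    by (rule prob_space_bandit_space) fact
  have sets: "sets (\<Theta> j) = sets borel" if "j \<in> {1..N}" for j
    using inst that by (auto simp: bandit_instance_def)
  have arm: "(\<lambda>\<omega>. of_bool (qcare_arm N \<alpha> \<omega> t = i) :: real) \<in> borel_measurable ?P"
    if "t \<ge> 1" for i t
    by (rule measurable_of_bool_qcare_arm[OF sets that])
  \<comment> \<open>Exactly one indicator is nonzero. This trades evaluation at a random arm for a
    finite sum over fixed arms.\<close>
  have split: "f (qcare_arm N \<alpha> \<omega> t) = (\<Sum>i = 1..N. of_bool (qcare_arm N \<alpha> \<omega> t = i) * f i)"
    for f :: "nat \<Rightarrow> real" and \<omega> t
    using qcare_arm_in[OF N, of \<alpha> \<omega> t]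
    by (subst sum.remove[of _ "qcare_arm N \<alpha> \<omega> t"]) (auto intro!: sum.neutral)
  have int_r: "integrable ?P (\<lambda>\<omega>. of_bool (qcare_arm N \<alpha> \<omega> t = i) * fst \<omega> (i, t))"
    if "i \<in> {1..N}" "t \<ge> 1" for i t
    using integrable_reward[OF inst that]
    by (rule Bochner_Integration.integrable_bound) (use arm[OF that(2)] measurable_reward[OF sets that] in auto)
  have int_m: "integrable ?P (\<lambda>\<omega>. of_bool (qcare_arm N \<alpha> \<omega> t = i) * arm_mean \<Theta> i)"
    if "t \<ge> 1" for i t
    using arm[OF that] by (intro integrable_mult_left integrable_const_bound[of _ 1]) auto
  have int_reward: "integrable ?P (\<lambda>\<omega>. fst \<omega> (qcare_arm N \<alpha> \<omega> t, t))" if "t \<ge> 1" for t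
    unfolding split[of "\<lambda>i. fst _ (i, t)"] using int_r that
    by (intro Bochner_Integration.integrable_sum) auto
  have mean_reward: "(\<integral>\<omega>. fst \<omega> (qcare_arm N \<alpha> \<omega> t, t) \<partial>?P) = (\<integral>\<omega>. arm_mean \<Theta> (qcare_arm N \<alpha> \<omega> t) \<partial>?P)"
    if t: "t \<ge> 1" for t
  proof -
    have "(\<integral>\<omega>. fst \<omega> (qcare_arm N \<alpha> \<omega> t, t) \<partial>?P) =
        (\<integral>\<omega>. (\<Sum>i = 1..N. of_bool (qcare_arm N \<alpha> \<omega> t = i) * fst \<omega> (i, t)) \<partial>?P)"
      by (subst split[of "\<lambda>i. fst _ (i, t)"]) (rule refl)
    also have "\<dots> = (\<Sum>i = 1..N. \<integral>\<omega>. of_bool (qcare_arm N \<alpha> \<omega> t = i) * fst \<omega> (i, t) \<partial>?P)"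
      using int_r t by (intro Bochner_Integration.integral_sum)
    also have "\<dots> = (\<Sum>i = 1..N. \<integral>\<omega>. of_bool (qcare_arm N \<alpha> \<omega> t = i) * arm_mean \<Theta> i \<partial>?P)"
      by (intro sum.cong refl integral_of_bool_mult_reward inst t)
    also have "\<dots> = (\<integral>\<omega>. (\<Sum>i = 1..N. of_bool (qcare_arm N \<alpha> \<omega> t = i) * arm_mean \<Theta> i) \<partial>?P)"
      using int_m t by (intro Bochner_Integration.integral_sum[symmetric])
    also have "\<dots> = (\<integral>\<omega>. arm_mean \<Theta> (qcare_arm N \<alpha> \<omega> t) \<partial>?P)"
      by (subst split[of "arm_mean \<Theta>"]) (rule refl)
    finally show ?thesis .
  qed
  have "(\<integral>\<omega>. (\<Sum>t = 1..T. best_mean N \<Theta> - arm_mean \<Theta> (qcare_arm N \<alpha> \<omega> t)) \<partial>?P) =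
      (\<Sum>t = 1..T. best_mean N \<Theta> - (\<integral>\<omega>. arm_mean \<Theta> (qcare_arm N \<alpha> \<omega> t) \<partial>?P))"
    using integrable_arm_mean_qcare_arm[OF inst N] by (subst Bochner_Integration.integral_sum) (auto simp: prob_space)
  also have "\<dots> = best_mean N \<Theta> * real T - (\<Sum>t = 1..T. \<integral>\<omega>. fst \<omega> (qcare_arm N \<alpha> \<omega> t, t) \<partial>?P)"
    using mean_reward by (simp add: sum_subtractf mult.commute)
  also have "(\<Sum>t = 1..T. \<integral>\<omega>. fst \<omega> (qcare_arm N \<alpha> \<omega> t, t) \<partial>?P) =
      (\<integral>\<omega>. (\<Sum>t = 1..T. fst \<omega> (qcare_arm N \<alpha> \<omega> t, t)) \<partial>?P)"
    using int_reward by (intro Bochner_Integration.integral_sum[symmetric]) auto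
  finally show ?thesis
    by (simp only: regret_def)
qed

lemma integrable_gaps:
  assumes "bandit_instance N \<Theta>" "N \<ge> 1"
  shows "integrable (bandit_space N \<Theta>)
    (\<lambda>\<omega>. \<Sum>t = 1..T. best_mean N \<Theta> - arm_mean \<Theta> (qcare_arm N \<alpha> \<omega> t))"
proof -
  interpret prob_space "bandit_space N \<Theta>"
    by (rule prob_space_bandit_space) fact
  show ?thesis
    by (intro Bochner_Integration.integrable_sum Bochner_Integration.integrable_diff
        integrable_arm_mean_qcare_arm integrable_const assms) auto
qed

text \<open>Markov's inequality for the nonnegative sum of gaps. It converts a lower bound on the
  probability of large gaps into one on the regret.\<close>

lemma regret_ge:
  assumes inst: "bandit_instance N \<Theta>" and N: "N \<ge> 1" and "x > 0"
  shows "x * measure (bandit_space N \<Theta>) {\<omega> \<in> space (bandit_space N \<Theta>).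
      (\<Sum>t = 1..T. best_mean N \<Theta> - arm_mean \<Theta> (qcare_arm N \<alpha> \<omega> t)) \<ge> x} \<le> regret N \<alpha> \<Theta> T"
proof -
  interpret prob_space "bandit_space N \<Theta>"
    by (rule prob_space_bandit_space) fact
  have gap: "0 \<le> best_mean N \<Theta> - arm_mean \<Theta> (qcare_arm N \<alpha> \<omega> t)" for \<omega> t
    using qcare_arm_in[OF N] by (auto simp: best_mean_def intro!: Max_ge)
  have "prob {\<omega> \<in> space (bandit_space N \<Theta>).
      (\<Sum>t = 1..T. best_mean N \<Theta> - arm_mean \<Theta> (qcare_arm N \<alpha> \<omega> t)) \<ge> x} \<le> regret N \<alpha> \<Theta> T / x"
    unfolding regret_eq_expected_gaps[OF inst N]
    by (rule integral_Markov_inequality_measure[OF integrable_gaps[OF inst N], where A = "{}"])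
      (use gap \<open>x > 0\<close> in \<open>auto intro!: AE_I2 sum_nonneg\<close>)
  then show ?thesis
    using \<open>x > 0\<close> by (simp only: pos_le_divide_eq mult.commute)
qed

subsection \<open>The standard normal distribution and product boxes\<close>

abbreviation std_normal :: "real measure" where
  "std_normal \<equiv> density lborel std_normal_density"

text \<open>For \<open>x \<ge> L \<ge> 0\<close> one has
  \<open>x\<^sup>2 \<ge> L\<^sup>2 + (x - L)\<^sup>2\<close>, so on the tail the density is at most
  \<open>exp (- L\<^sup>2 / 2)\<close> times the normal density centred at \<open>L\<close>, whose
  total mass is 1.\<close>

lemma std_normal_upper_tail:
  assumes "L \<ge> 0"
  shows "measure std_normal {L..} \<le> exp (- L\<^sup>2 / 2)"
proof -
  have "emeasure std_normal {L..} = (\<integral>\<^sup>+x. ennreal (std_normal_density x) * indicator {L..} x \<partial>lborel)"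
    by (simp add: emeasure_density)
  also have "\<dots> \<le> (\<integral>\<^sup>+x. ennreal (exp (- L\<^sup>2 / 2)) * ennreal (normal_density L 1 x) \<partial>lborel)"
  proof (intro nn_integral_mono)
    fix x
    have "exp (- x\<^sup>2 / 2) \<le> exp (- L\<^sup>2 / 2) * exp (- (x - L)\<^sup>2 / 2)" if "x \<ge> L"
    proof -
      have "L * L \<le> L * x"
        using that assms by (intro mult_left_mono)
      then have "- x\<^sup>2 / 2 \<le> - L\<^sup>2 / 2 - (x - L)\<^sup>2 / 2"
        by (simp add: power2_eq_square field_simps)
      then show ?thesis
        by (simp flip: exp_add)
    qed
    then show "ennreal (std_normal_density x) * indicator {L..} x
        \<le> ennreal (exp (- L\<^sup>2 / 2)) * ennreal (normal_density L 1 x)"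
      by (auto simp: normal_density_def divide_simps split: split_indicator simp flip: ennreal_mult)
  qed
  also have "\<dots> = ennreal (exp (- L\<^sup>2 / 2)) * emeasure (density lborel (normal_density L 1)) UNIV"
    by (simp add: nn_integral_cmult emeasure_density)
  also have "emeasure (density lborel (normal_density L 1)) UNIV = 1"
    using prob_space.emeasure_space_1[OF prob_space_normal_density[of 1 L]] by simp
  finally show ?thesis
    by (simp add: measure_def enn2real_leI)
qed

text \<open>Reflection at 0 preserves the density and carries this tail to the upper one.\<close>

lemma std_normal_lower_tail:
  assumes "L \<ge> 0"
  shows "measure std_normal {..-L} \<le> exp (- L\<^sup>2 / 2)"
proof -
  have "emeasure std_normal {..-L} = (\<integral>\<^sup>+x. ennreal (std_normal_density x) * indicator {..-L} x \<partial>lborel)"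
    by (simp add: emeasure_density)
  also have "\<dots> = (\<integral>\<^sup>+x. ennreal (std_normal_density (- x)) * indicator {..-L} (- x) \<partial>lborel)"
    by (subst nn_integral_real_affine[where c = "-1" and t = 0]) auto
  also have "\<dots> = (\<integral>\<^sup>+x. ennreal (std_normal_density x) * indicator {L..} x \<partial>lborel)"
    by (intro nn_integral_cong) (auto simp: std_normal_density_def split: split_indicator)
  also have "\<dots> = emeasure std_normal {L..}"
    by (simp add: emeasure_density)
  finally show ?thesis
    using std_normal_upper_tail[OF assms] by (simp add: measure_def)
qed

text \<open>The density vanishes nowhere, so a null interval would be null for Lebesgue measure too,
  contradicting its positive length.\<close>

lemma std_normal_Ioo_pos:
  assumes "a < b"
  shows "measure std_normal {a<..<b} > 0"
proof (rule ccontr)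
  interpret prob_space std_normal
    by (rule prob_space_normal_density) simp
  assume "\<not> ?thesis"
  then have "{a<..<b} \<in> null_sets std_normal"
    by (auto simp: null_sets_def emeasure_eq_measure not_less intro: antisym)
  then have "AE x in lborel. x \<notin> {a<..<b}"
    by (subst (asm) null_sets_density_iff) (auto simp: not_le normal_density_pos[THEN less_imp_neq, symmetric])
  then have "emeasure lborel {a<..<b} = 0"
    by (subst (asm) AE_iff_measurable[of "{a<..<b}"]) auto
  with assms show False
    by simp
qed

text \<open>Finitely many constrained coordinates of a possibly infinite product form a cylinder
  set, whose measure is the product of its factors. The trap is a pair of such boxes.\<close>

lemma measure_PiM_box:
  assumes M: "\<And>i. i \<in> I \<Longrightarrow> prob_space (M i)"
    and J: "J \<subseteq> I" "finite J" and A: "\<And>i. i \<in> J \<Longrightarrow> A i \<in> sets (M i)"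
  shows "measure (PiM I M) {x \<in> space (PiM I M). \<forall>i\<in>J. x i \<in> A i} = (\<Prod>i\<in>J. measure (M i) (A i))"
proof -
  have "{x \<in> space (PiM I M). \<forall>i\<in>J. x i \<in> A i} = prod_emb I M J (Pi\<^sub>E J A)"
    unfolding prod_emb_def using J(1) by (auto simp: space_PiM restrict_PiE_iff)
  then have "emeasure (PiM I M) {x \<in> space (PiM I M). \<forall>i\<in>J. x i \<in> A i} = (\<Prod>i\<in>J. emeasure (M i) (A i))"
    using emeasure_PiM_emb[OF M J A] by simp
  also have "\<dots> = (\<Prod>i\<in>J. ennreal (measure (M i) (A i)))"
    using M J(1) by (intro prod.cong refl finite_measure.emeasure_eq_measure)
      (auto simp: prob_space_def)
  also have "\<dots> = ennreal (\<Prod>i\<in>J. measure (M i) (A i))"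
    by (simp add: prod_ennreal)
  finally show ?thesis
    by (simp add: measure_def[of "PiM I M"] prod_nonneg)
qed

subsection \<open>The trap\<close>

text \<open>Arm 1 is optimal, yet shows any given number of zeros in a row with exponentially small
  but positive probability. The constant reward of arm 2 lies strictly between 0 and the mean of arm
  1, and being deterministic it makes the empirical mean of arm 2 explicit.\<close>

definition hard_instance :: "nat \<Rightarrow> real measure" where
  "hard_instance i =
     (if i = 1 then distr (measure_pmf (bernoulli_pmf (1 / 2))) borel of_bool else return borel (1 / 4))"

lemma sets_hard_instance: "sets (hard_instance i) = sets borel"
  by (simp add: hard_instance_def)

lemma prob_space_hard_instance: "prob_space (hard_instance i)"
  by (auto simp: hard_instance_def intro!: prob_space.prob_space_distr prob_space_measure_pmf prob_space_return)

lemma arm_mean_hard_instance: "arm_mean hard_instance i = (if i = 1 then 1 / 2 else 1 / 4)"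
proof -
  have "(\<integral>x. x \<partial>distr (measure_pmf (bernoulli_pmf (1 / 2))) borel (of_bool :: bool \<Rightarrow> real)) = 1 / 2"
    by (subst integral_distr) auto
  moreover have "(\<integral>x. x \<partial>return borel (1 / 4 :: real)) = 1 / 4"
    by (subst integral_return) auto
  ultimately show ?thesis
    by (simp add: arm_mean_def hard_instance_def)
qed

lemma measure_hard_instance_1_zero: "measure (hard_instance 1) {0} = 1 / 2"
proof -
  have "of_bool -` {0 :: real} = {False}"
    by auto
  then show ?thesis
    by (simp add: hard_instance_def measure_distr measure_pmf_single)
qed

lemma best_mean_hard_instance: "best_mean 2 hard_instance = 1 / 2"
proof -
  have "{1..2::nat} = {1, 2}"
    by auto
  then show ?thesis
    by (simp add: best_mean_def arm_mean_hard_instance)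
qed

lemma bandit_instance_hard_instance: "bandit_instance 2 hard_instance"
  unfolding bandit_instance_def
proof (intro conjI ballI)
  show "\<exists>!i. i \<in> {1..2} \<and> arm_mean hard_instance i = best_mean 2 hard_instance"
    by (rule ex1I[of _ 1]) (auto simp: best_mean_hard_instance arm_mean_hard_instance split: if_splits)
  show "AE x in hard_instance i. x \<in> {0..1}" for i
  proof (cases "i = 1")
    case True
    then show ?thesis
      unfolding hard_instance_def by (subst if_P, simp, subst AE_distr_iff) auto
  next
    case False
    then show ?thesis
      unfolding hard_instance_def by (subst if_not_P, simp, subst AE_return) auto
  qed
qed (simp_all add: sets_hard_instance prob_space_hard_instance)

text \<open>Before round \<open>t\<close> there are \<open>t - 1\<close> rounds. Truncated
  subtraction makes the formulas valid in every phase, with no pull of arm 2 as long as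
  \<open>t \<le> K + 1\<close>. Only rounds before \<open>t\<close> are assumed known, which suits
  an induction over \<open>t\<close>.\<close>

lemma pulls_explore_then_commit:
  assumes "\<And>l. l \<in> {1..<t} \<Longrightarrow> a l = (if l \<le> K then 1 else 2)"
  shows "pulls a 1 t = min (t - 1) K" "pulls a 2 t = t - 1 - K"
proof -
  have a: "a l = 1 \<longleftrightarrow> l \<le> K" "a l = 2 \<longleftrightarrow> K < l" if "l \<in> {1..<t}" for l
    using assms[OF that] by auto
  have "{l \<in> {1..<t}. a l = 1} = {l \<in> {1..<t}. l \<le> K}"
    using a(1) by (intro Collect_cong conj_cong) auto
  also have "\<dots> = {1..min (t - 1) K}"
    by auto
  finally have "{l \<in> {1..<t}. a l = 1} = {1..min (t - 1) K}" .
  then show "pulls a 1 t = min (t - 1) K"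
    by (simp add: pulls_def)
  have "{l \<in> {1..<t}. a l = 2} = {l \<in> {1..<t}. K < l}"
    using a(2) by (intro Collect_cong conj_cong) auto
  also have "\<dots> = {Suc K..<t}"
    by auto
  finally have "{l \<in> {1..<t}. a l = 2} = {Suc K..<t}" .
  then show "pulls a 2 t = t - 1 - K"
    by (simp add: pulls_def)
qed

text \<open>Noise signs force arm 1 in rounds \<open>1..K\<close> and arm 2 in rounds \<open>K+1..2*K\<close>; afterwards both noises are
  only bounded on the harmful side by \<open>L\<close>, so that the two indices stay on either side of \<open>1 / 16\<close>.\<close>

definition trap_reward :: "nat \<Rightarrow> nat \<times> nat \<Rightarrow> real set" where
  "trap_reward K = (\<lambda>(i, t). if i = 1 then (if t \<le> K then {0} else UNIV) else {1 / 4})"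

definition trap_noise :: "nat \<Rightarrow> real \<Rightarrow> nat \<times> nat \<Rightarrow> real set" where
  "trap_noise K L = (\<lambda>(i, t).
     if t \<le> K then (if i = 1 then {0<..} else {..<0})
     else if t \<le> 2 * K then (if i = 1 then {..<0} else {0<..})
     else (if i = 1 then {..<L} else {-L<..}))"

text \<open>Strong induction over time: once the past actions are known, the pulls and both
  empirical means are explicit, and only the current noises remain to be compared. The bound on
  \<open>16 * L\<close> limits the harmful effect of late noise on either index to
  \<open>1 / 16\<close>.\<close>

lemma trap_action:
  assumes K: "K \<ge> 1" and \<alpha>: "\<alpha> > 0" and L: "16 * L \<le> real (K + 1) powr \<alpha>" "L \<ge> 0"
    and r: "\<And>i t. i \<in> {1..2} \<Longrightarrow> t \<in> {1..T} \<Longrightarrow> r (i, t) \<in> trap_reward K (i, t)"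
    and e: "\<And>i t. i \<in> {1..2} \<Longrightarrow> t \<in> {1..T} \<Longrightarrow> e (i, t) \<in> trap_noise K L (i, t)"
    and t: "t \<in> {1..T}"
  shows "qcare_action 2 \<alpha> r e t = (if t \<le> K then 1 else 2)"
  using t
proof (induction t rule: less_induct)
  case (less t)
  define a where "a = qcare_action 2 \<alpha> r e"
  have IH: "a l = (if l \<le> K then 1 else 2)" if "l \<in> {1..<t}" for l
    unfolding a_def by (rule less.IH) (use that less.prems in auto)
  have pulls: "pulls a 1 t = min (t - 1) K" "pulls a 2 t = t - 1 - K"
    by (rule pulls_explore_then_commit[OF IH]; assumption)+
  have r1: "r (1, l) = 0" if "l \<in> {1..<t}" "a l = 1" for l
  proof -
    have "l \<le> K"
      using IH[OF that(1)] that(2) by (cases "l \<le> K") simp_all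
    then show ?thesis
      using r[of 1 l] that(1) less.prems by (simp add: trap_reward_def)
  qed
  have mean1: "emp_mean a r 1 t = 0"
    unfolding emp_mean_def using r1 by (auto intro!: sum.neutral)
  have r2: "r (2, l) = 1 / 4" if "l \<in> {1..<t}" for l
    using r[of 2 l] that less.prems by (auto simp: trap_reward_def)
  have "(\<Sum>l | l \<in> {1..<t} \<and> a l = 2. r (2, l)) = (\<Sum>l | l \<in> {1..<t} \<and> a l = 2. 1 / 4)"
    using r2 by (intro sum.cong) auto
  also have "\<dots> = real (pulls a 2 t) / 4"
    by (simp add: pulls_def)
  finally have mean2: "emp_mean a r 2 t = real (pulls a 2 t) / 4 / (real (pulls a 2 t) + 1)"
    by (simp only: emp_mean_def)
  let ?\<theta> = "\<lambda>i. qcare_index \<alpha> a r e i t"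
  have \<theta>1: "?\<theta> 1 = e (1, t) / (real (pulls a 1 t) + 1) powr \<alpha>"
    by (simp only: qcare_index_def mean1 add_0)
  have \<theta>2: "?\<theta> 2 = real (pulls a 2 t) / 4 / (real (pulls a 2 t) + 1) + e (2, t) / (real (pulls a 2 t) + 1) powr \<alpha>"
    by (simp only: qcare_index_def mean2)
  have e1: "e (1, t) \<in> trap_noise K L (1, t)" and e2: "e (2, t) \<in> trap_noise K L (2, t)"
    using e less.prems by auto
  have act: "qcare_action 2 \<alpha> r e t = (if ?\<theta> 2 \<le> ?\<theta> 1 then 1 else 2)"
    unfolding a_def by (subst qcare_action_eq) (rule argmax_arm_2)
  consider "t \<le> K" | "K < t" "t \<le> 2 * K" | "2 * K < t"
    by linarith
  then show ?case
  proof cases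
    \<comment> \<open>Arm 2 has not been played yet, so both empirical means are 0 and the signs of
      the noises decide.\<close>
    case 1
    then have "?\<theta> 2 < 0" "?\<theta> 1 > 0"
      unfolding \<theta>1 \<theta>2 using e1 e2 by (auto simp: trap_noise_def pulls)
    with 1 act show ?thesis
      by simp
  next
    case 2
    then have "?\<theta> 1 < 0"
      unfolding \<theta>1 using e1 by (auto simp: trap_noise_def divide_neg_pos)
    moreover have "?\<theta> 2 > 0"
      unfolding \<theta>2 using e2 2 by (intro add_nonneg_pos) (auto simp: trap_noise_def)
    ultimately show ?thesis
      using 2 act by simp
  next
    case 3
    define m where "m = pulls a 2 t"
    \<comment> \<open>This is what the second forced phase achieves: arm 2 has at least
      \<open>K\<close> pulls, so its noise is damped at least as strongly as that of arm 1.\<close>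
    have m: "m \<ge> K"
      using 3 by (simp add: m_def pulls)
    have pulls1: "pulls a 1 t = K"
      unfolding pulls using 3 by simp
    have "e (1, t) < real (K + 1) powr \<alpha> / 16"
      using e1 L 3 by (auto simp: trap_noise_def)
    then have "?\<theta> 1 < 1 / 16"
      unfolding \<theta>1 pulls1 by (simp add: divide_simps add.commute)
    moreover have "?\<theta> 2 > 1 / 16"
    proof -
      have "real (K + 1) powr \<alpha> \<le> real (m + 1) powr \<alpha>"
        using m \<alpha> by (intro powr_mono2) auto
      then have "e (2, t) > - ((real m + 1) powr \<alpha> / 16)"
        using e2 L 3 by (auto simp: trap_noise_def add.commute)
      then have "e (2, t) / (real m + 1) powr \<alpha> > - 1 / 16"
        by (simp add: divide_simps)
      \<comment> \<open>As \<open>m \<ge> 1\<close>, the shrinkage factor \<open>m / (m + 1)\<close>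
        is at least \<open>1 / 2\<close>. The empirical mean is thus at least \<open>1 / 8\<close>,
        and losing less than \<open>1 / 16\<close> to the noise keeps the index above
        \<open>1 / 16\<close>.\<close>
      moreover have "real m / 4 / (real m + 1) \<ge> 1 / 8"
        using m K by (simp add: divide_simps)
      ultimately show ?thesis
        unfolding \<theta>2 m_def[symmetric] by linarith
    qed
    ultimately show ?thesis
      using 3 act by simp
  qed
qed

text \<open>The trap is a box in the independent reward and noise tables, so its probability is a
  product over entries. The forced entries contribute a power of a constant, the late noises a
  product that Bernoulli's inequality bounds below. That \<open>q\<close> is chosen before
  \<open>\<alpha>\<close>, \<open>K\<close>, \<open>T\<close> and \<open>L\<close> allows all of
  these to vary later.\<close>

lemma trap_probability:
  obtains q where "0 < q" "q < 1"
    "\<And>\<alpha> K T L. \<lbrakk>\<alpha> > 0; K \<ge> 1; 2 * K \<le> T; 0 \<le> L; 16 * L \<le> real (K + 1) powr \<alpha>\<rbrakk> \<Longrightarrow>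
       q ^ K * (1 - 2 * real T * exp (- L\<^sup>2 / 2)) \<le>
         measure (bandit_space 2 hard_instance)
           {\<omega> \<in> space (bandit_space 2 hard_instance).
             \<forall>t\<in>{1..T}. qcare_arm 2 \<alpha> \<omega> t = (if t \<le> K then 1 else 2)}"
proof -
  interpret Z: prob_space std_normal
    by (rule prob_space_normal_density) simp
  define p where "p = min (measure std_normal {0<..}) (measure std_normal {..<0})"
  have "measure std_normal {0<..} > 0"
    by (rule less_le_trans[OF std_normal_Ioo_pos[of 0 1]]) (auto intro!: Z.finite_measure_mono)
  moreover have "measure std_normal {..<0} > 0"
    by (rule less_le_trans[OF std_normal_Ioo_pos[of "-1" 0]]) (auto intro!: Z.finite_measure_mono)
  ultimately have p: "p > 0" "p \<le> 1"
    by (auto simp: p_def min_le_iff_disj)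
  \<comment> \<open>Each unit of \<open>K\<close> costs four prescribed noise signs, for two arms in
    each of two phases, and one zero reward of arm 1, which has probability
    \<open>1 / 2\<close>.\<close>
  define q where "q = p ^ 4 / 2"
  have q: "0 < q" "q < 1"
    using p power_le_one[of p 4] by (auto simp: q_def)
  show thesis
  proof (rule that[OF q])
    fix \<alpha> L :: real and K T :: nat
    assume \<alpha>: "\<alpha> > 0" and K: "K \<ge> 1" and T: "2 * K \<le> T" and L0: "0 \<le> L"
      and L: "16 * L \<le> real (K + 1) powr \<alpha>"
    let ?I = "{1..2} \<times> {1::nat..}"
    define J where "J = {1..2::nat} \<times> {1..T}"
    define R where "R = (\<Pi>\<^sub>M (i, t)\<in>?I. hard_instance i)"
    define E where "E = (\<Pi>\<^sub>M (i::nat, t::nat)\<in>?I. std_normal)"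
    define \<delta> where "\<delta> = exp (- L\<^sup>2 / 2)"
    define BR where "BR = {r \<in> space R. \<forall>j\<in>J. r j \<in> trap_reward K j}"
    define BE where "BE = {e \<in> space E. \<forall>j\<in>J. e j \<in> trap_noise K L j}"
    have P: "bandit_space 2 hard_instance = R \<Otimes>\<^sub>M E"
      unfolding bandit_space_def R_def E_def ..
    interpret R: prob_space R
      unfolding R_def by (rule prob_space_rewards bandit_instance_hard_instance)+
    interpret E: prob_space E
      unfolding E_def by (rule prob_space_noise)
    interpret RE: pair_prob_space R E ..
    have \<delta>: "0 \<le> \<delta>" "\<delta> \<le> 1"
      by (auto simp: \<delta>_def)
    have J: "finite J" "J \<subseteq> ?I"
      by (auto simp: J_def)
    have R_sets: "trap_reward K (i, t) \<in> sets (hard_instance i)" for i t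
      by (simp add: sets_hard_instance trap_reward_def)
    have E_sets: "trap_noise K L (i, t) \<in> sets std_normal" for i t
      by (simp add: trap_noise_def)
    have BR_sets: "BR \<in> sets R"
      unfolding BR_def
    proof (rule sets.sets_Collect_finite_All)
      fix j assume "j \<in> J"
      with J(2) have "(\<lambda>r. r j) \<in> R \<rightarrow>\<^sub>M (\<lambda>(i, t). hard_instance i) j"
        unfolding R_def by (intro measurable_component_singleton) auto
      then show "{r \<in> space R. r j \<in> trap_reward K j} \<in> sets R"
        by (rule measurable_sets_Collect) (use R_sets[of "fst j" "snd j"] in \<open>simp add: case_prod_unfold\<close>)
    qed (rule J)
    have BE_sets: "BE \<in> sets E"
      unfolding BE_def
    proof (rule sets.sets_Collect_finite_All)
      fix j assume "j \<in> J"
      with J(2) have "(\<lambda>r. r j) \<in> E \<rightarrow>\<^sub>M (\<lambda>(i, t). std_normal) j"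
        unfolding E_def by (intro measurable_component_singleton) auto
      then show "{e \<in> space E. e j \<in> trap_noise K L j} \<in> sets E"
        by (rule measurable_sets_Collect) (use E_sets[of "fst j" "snd j"] in \<open>simp add: case_prod_unfold\<close>)
    qed (rule J)
    \<comment> \<open>Apart from the first \<open>K\<close> rewards of arm 1, the reward constraints
      hold almost surely.\<close>
    have half: "measure (hard_instance i) (trap_reward K (i, t)) = (if i = 1 \<and> t \<le> K then 1 / 2 else 1)" for i t
    proof -
      interpret prob_space "hard_instance i"
        by (rule prob_space_hard_instance)
      have "measure (hard_instance i) UNIV = 1"
        using prob_space sets_eq_imp_space_eq[OF sets_hard_instance[of i]] by simp
      moreover have "measure (hard_instance i) {1 / 4} = 1" if "i \<noteq> 1"
        using that by (simp add: hard_instance_def measure_return)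
      ultimately show ?thesis
        using measure_hard_instance_1_zero by (auto simp: trap_reward_def)
    qed
    have "measure R BR = (\<Prod>(i, t)\<in>J. measure (hard_instance i) (trap_reward K (i, t)))"
      unfolding R_def BR_def
      by (subst measure_PiM_box) (use J R_sets prob_space_hard_instance in \<open>auto simp: case_prod_unfold\<close>)
    also have "\<dots> = (\<Prod>i\<in>{1..2::nat}. \<Prod>t\<in>{1..T}. if i = 1 \<and> t \<le> K then 1 / 2 else 1)"
      unfolding J_def half by (rule prod.cartesian_product[symmetric])
    also have "\<dots> = (\<Prod>t\<in>{1..T}. if t \<le> K then 1 / 2 else 1)"
      by (simp add: numeral_2_eq_2)
    also have "\<dots> = (1 / 2) ^ K"
    proof -
      have "{1..T} \<inter> {t. t \<le> K} = {1..K}"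
        using T by auto
      then show ?thesis
        by (subst prod.If_cases) (simp_all add: power_divide)
    qed
    finally have measure_BR: "measure R BR = (1 / 2) ^ K" .
    have noise: "(if t \<le> 2 * K then p else 1 - \<delta>) \<le> measure std_normal (trap_noise K L (i, t))" for i t
    proof -
      have "1 - \<delta> \<le> measure std_normal {..<L}"
      proof -
        have "- {..<L} = {L..}"
          by auto
        then show ?thesis
          using Z.prob_compl[of "{..<L}"] std_normal_upper_tail[OF L0] by (simp add: \<delta>_def Compl_eq_Diff_UNIV)
      qed
      moreover have "1 - \<delta> \<le> measure std_normal {-L<..}"
      proof -
        have "- {-L<..} = {..-L}"
          by auto
        then show ?thesis
          using Z.prob_compl[of "{-L<..}"] std_normal_lower_tail[OF L0] by (simp add: \<delta>_def Compl_eq_Diff_UNIV)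
      qed
      ultimately show ?thesis
        by (auto simp: trap_noise_def p_def)
    qed
    \<comment> \<open>Bernoulli's inequality plays the role of a union bound over the
      \<open>2 * (T - 2 * K)\<close> late noises, each of which fails with probability at most
      \<open>\<delta>\<close>.\<close>
    have "1 - 2 * real T * \<delta> \<le> 1 + real (2 * (T - 2 * K)) * (- \<delta>)"
      using \<delta> by (simp add: mult_right_mono)
    also have "\<dots> \<le> (1 + - \<delta>) ^ (2 * (T - 2 * K))"
      using \<delta> by (intro Bernoulli_inequality) simp
    finally have "p ^ (4 * K) * (1 - 2 * real T * \<delta>) \<le> p ^ (4 * K) * (1 - \<delta>) ^ (2 * (T - 2 * K))"
      using p by (intro mult_left_mono) auto
    \<comment> \<open>The bounds in \<open>noise\<close> do not distinguish the arms, so the product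
      over both arms is the square of a product over rounds.\<close>
    also have "\<dots> = (p ^ (2 * K) * (1 - \<delta>) ^ (T - 2 * K)) ^ 2"
      by (simp add: power_mult_distrib flip: power_mult) (simp add: mult.commute mult.left_commute)
    also have "p ^ (2 * K) * (1 - \<delta>) ^ (T - 2 * K) = (\<Prod>t\<in>{1..T}. if t \<le> 2 * K then p else 1 - \<delta>)"
    proof -
      have "{1..T} \<inter> {t. t \<le> 2 * K} = {1..2 * K}" "{1..T} \<inter> - {t. t \<le> 2 * K} = {2 * K<..T}"
        using T by auto
      then show ?thesis
        by (subst prod.If_cases) simp_all
    qed
    also have "\<dots> ^ 2 = (\<Prod>i\<in>{1..2::nat}. \<Prod>t\<in>{1..T}. if t \<le> 2 * K then p else 1 - \<delta>)"
      by simp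
    also have "\<dots> = (\<Prod>(i, t)\<in>J. if t \<le> 2 * K then p else 1 - \<delta>)"
      unfolding J_def by (rule prod.cartesian_product)
    also have "\<dots> \<le> (\<Prod>(i, t)\<in>J. measure std_normal (trap_noise K L (i, t)))"
      using noise p \<delta> by (intro prod_mono) auto
    also have "\<dots> = measure E BE"
      unfolding E_def BE_def
      by (subst measure_PiM_box) (use J E_sets Z.prob_space_axioms in \<open>auto simp: case_prod_unfold\<close>)
    finally have measure_BE: "p ^ (4 * K) * (1 - 2 * real T * \<delta>) \<le> measure E BE" .
    have "q ^ K * (1 - 2 * real T * exp (- L\<^sup>2 / 2)) = (1 / 2) ^ K * (p ^ (4 * K) * (1 - 2 * real T * \<delta>))"
      by (simp add: q_def \<delta>_def power_divide power_mult)
    also have "\<dots> \<le> measure R BR * measure E BE"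
      unfolding measure_BR by (intro mult_left_mono measure_BE) auto
    also have "\<dots> = measure (R \<Otimes>\<^sub>M E) (BR \<times> BE)"
      using BR_sets BE_sets by (simp add: measure_def E.emeasure_pair_measure_Times enn2real_mult)
    also have "\<dots> \<le> measure (R \<Otimes>\<^sub>M E)
        {\<omega> \<in> space (R \<Otimes>\<^sub>M E). \<forall>t\<in>{1..T}. qcare_arm 2 \<alpha> \<omega> t = (if t \<le> K then 1 else 2)}"
    proof (rule RE.finite_measure_mono)
      show "BR \<times> BE \<subseteq> {\<omega> \<in> space (R \<Otimes>\<^sub>M E). \<forall>t\<in>{1..T}. qcare_arm 2 \<alpha> \<omega> t = (if t \<le> K then 1 else 2)}"
        using trap_action[OF K \<alpha> L L0, of T]
        by (auto simp: BR_def BE_def J_def space_pair_measure qcare_arm_def)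
      show "{\<omega> \<in> space (R \<Otimes>\<^sub>M E). \<forall>t\<in>{1..T}. qcare_arm 2 \<alpha> \<omega> t = (if t \<le> K then 1 else 2)} \<in> sets (R \<Otimes>\<^sub>M E)"
      proof (rule sets.sets_Collect_finite_All)
        fix t assume "t \<in> {1..T}"
        then have "(\<lambda>\<omega>. qcare_arm 2 \<alpha> \<omega> t) \<in> R \<Otimes>\<^sub>M E \<rightarrow>\<^sub>M count_space UNIV"
          unfolding P[symmetric] by (intro measurable_qcare_arm sets_hard_instance) auto
        then show "{\<omega> \<in> space (R \<Otimes>\<^sub>M E). qcare_arm 2 \<alpha> \<omega> t = (if t \<le> K then 1 else 2)} \<in> sets (R \<Otimes>\<^sub>M E)"
          by (rule measurable_sets_Collect) simp
      qed simp
    qed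
    finally show "q ^ K * (1 - 2 * real T * exp (- L\<^sup>2 / 2)) \<le>
         measure (bandit_space 2 hard_instance)
           {\<omega> \<in> space (bandit_space 2 hard_instance).
             \<forall>t\<in>{1..T}. qcare_arm 2 \<alpha> \<omega> t = (if t \<le> K then 1 else 2)}"
      unfolding P .
  qed
qed

subsection \<open>Asymptotics\<close>

text \<open>With \<open>L = 2 * sqrt (ln T)\<close> the tail \<open>exp (- L\<^sup>2 / 2) = T powr (-2)\<close> survives a union bound over \<open>2 * T\<close>
  noises, and this exploration length is what \<open>16 * L \<le> real (K + 1) powr \<alpha>\<close> then asks for.\<close>

definition explore :: "real \<Rightarrow> nat \<Rightarrow> nat" where
  "explore \<alpha> T = nat \<lceil>(32 * sqrt (ln T)) powr (1 / \<alpha>)\<rceil>"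

text \<open>Up to constants and rounding, the numerator is \<open>ln T\<close> to the power
  \<open>1 / (2 * \<alpha>)\<close>, and this exponent is below 1 exactly when
  \<open>\<alpha> > 1 / 2\<close>.\<close>

lemma explore_over_ln_tendsto_0:
  assumes "\<alpha> > 1 / 2"
  shows "(\<lambda>T. real (explore \<alpha> T) / ln T) \<longlonglongrightarrow> 0"
proof -
  define \<beta> where "\<beta> = 1 / \<alpha>"
  have \<beta>: "0 < \<beta>" "\<beta> < 2"
    using assms by (auto simp: \<beta>_def field_simps)
  have lim: "(\<lambda>T. ((32 * sqrt (ln T)) powr \<beta> + 1) / ln (real T)) \<longlonglongrightarrow> 0"
    using \<beta> by real_asymp
  have bound: "real (explore \<alpha> T) / ln T \<le> ((32 * sqrt (ln T)) powr \<beta> + 1) / ln (real T)"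
    if "T \<ge> 3" for T
  proof -
    have "real (explore \<alpha> T) \<le> (32 * sqrt (ln T)) powr \<beta> + 1"
      unfolding explore_def \<beta>_def by (simp add: of_int_ceiling_le_add_one)
    then show ?thesis
      using that by (intro divide_right_mono) auto
  qed
  show ?thesis
  proof (rule tendsto_sandwich[OF _ _ tendsto_const lim])
    show "\<forall>\<^sub>F T in sequentially. 0 \<le> real (explore \<alpha> T) / ln T"
      by (intro eventually_sequentiallyI[of 1]) auto
    show "\<forall>\<^sub>F T in sequentially. real (explore \<alpha> T) / ln T \<le> ((32 * sqrt (ln T)) powr \<beta> + 1) / ln (real T)"
      using bound by (rule eventually_sequentiallyI)
  qed
qed

text \<open>Ensures that both forced phases fit into the horizon: eventually twice the exploration
  length is below \<open>ln T \<le> T - 1\<close>.\<close>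

lemma eventually_double_explore_le:
  assumes "\<alpha> > 1 / 2"
  shows "\<forall>\<^sub>F T in sequentially. 2 * explore \<alpha> T \<le> T"
proof -
  have "\<forall>\<^sub>F T in sequentially. real (explore \<alpha> T) / ln T < 1 / 2"
    using order_tendstoD(2)[OF explore_over_ln_tendsto_0[OF assms], of "1 / 2"] by simp
  then show ?thesis
    using eventually_ge_at_top[of 2]
  proof eventually_elim
    case (elim T)
    then have "2 * real (explore \<alpha> T) < ln T"
      by (simp add: field_simps)
    also have "ln (real T) \<le> real T - 1"
      using elim by (intro ln_le_minus_one) auto
    finally show ?case
      by linarith
  qed
qed

lemma asymp_OmegaI:
  assumes "c > 0" "\<forall>\<^sub>F T in sequentially. c \<le> f T / g T"
  shows "asymp_Omega f g"
proof -
  have "0 < ereal c"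
    using assms(1) by simp
  also have "ereal c \<le> liminf (\<lambda>T. ereal (f T / g T))"
    using assms(2) by (intro Liminf_bounded) (auto elim: eventually_mono)
  finally show ?thesis
    by (simp only: asymp_Omega_def)
qed

text \<open>The trap with \<open>K = explore \<alpha> T\<close> and
  \<open>L = 2 * sqrt (ln T)\<close> has probability at least \<open>q ^ K / 2\<close>, a power of
  \<open>T\<close> with vanishing exponent because \<open>K\<close> is of smaller order than
  \<open>ln T\<close>.\<close>

lemma linear_gaps_probability:
  fixes \<alpha> :: real
  assumes \<alpha>: "\<alpha> > 1 / 2"
  obtains \<eta> where "\<eta> \<longlonglongrightarrow> 0"
    "\<forall>\<^sub>F T in sequentially. real T powr (- \<eta> T) / 2 \<le>
       measure (bandit_space 2 hard_instance)
         {\<omega> \<in> space (bandit_space 2 hard_instance).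
           (\<Sum>t = 1..T. best_mean 2 hard_instance - arm_mean hard_instance (qcare_arm 2 \<alpha> \<omega> t)) \<ge> 1 / 8 * real T}"
proof -
  let ?P = "bandit_space 2 hard_instance"
  let ?S = "\<lambda>T \<omega>. \<Sum>t = 1..T. best_mean 2 hard_instance - arm_mean hard_instance (qcare_arm 2 \<alpha> \<omega> t)"
  interpret prob_space ?P
    by (rule prob_space_bandit_space bandit_instance_hard_instance)+
  obtain q where q: "0 < q" "q < 1" and trap:
    "\<And>\<alpha> K T L. \<lbrakk>\<alpha> > 0; K \<ge> 1; 2 * K \<le> T; 0 \<le> L; 16 * L \<le> real (K + 1) powr \<alpha>\<rbrakk> \<Longrightarrow>
       q ^ K * (1 - 2 * real T * exp (- L\<^sup>2 / 2)) \<le>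
         prob {\<omega> \<in> space ?P. \<forall>t\<in>{1..T}. qcare_arm 2 \<alpha> \<omega> t = (if t \<le> K then 1 else 2)}"
    by (rule trap_probability[OF that])
  \<comment> \<open>Solves \<open>T powr (- \<eta> T) = q ^ K\<close> for
    \<open>K = explore \<alpha> T\<close>.\<close>
  define \<eta> where "\<eta> T = - ln q * (real (explore \<alpha> T) / ln T)" for T
  show thesis
  proof (rule that)
    show "\<eta> \<longlonglongrightarrow> 0"
      unfolding \<eta>_def by (rule tendsto_mult_right_zero explore_over_ln_tendsto_0 \<alpha>)+
    show "\<forall>\<^sub>F T in sequentially. real T powr (- \<eta> T) / 2 \<le> prob {\<omega> \<in> space ?P. ?S T \<omega> \<ge> 1 / 8 * real T}"
      using eventually_double_explore_le[OF \<alpha>] eventually_ge_at_top[of 4]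
    proof eventually_elim
      case (elim T)
      define K where "K = explore \<alpha> T"
      define L where "L = 2 * sqrt (ln T)"
      have ln: "ln T > 0"
        using elim by simp
      have K_ge: "(32 * sqrt (ln T)) powr (1 / \<alpha>) \<le> real K"
        unfolding K_def explore_def by linarith
      have "0 < (32 * sqrt (ln T)) powr (1 / \<alpha>)"
        using ln by simp
      with K_ge have K: "K \<ge> 1"
        by linarith
      have "16 * L = ((32 * sqrt (ln T)) powr (1 / \<alpha>)) powr \<alpha>"
        using ln \<alpha> by (simp add: L_def powr_powr)
      also have "\<dots> \<le> real (K + 1) powr \<alpha>"
        using K_ge \<alpha> by (intro powr_mono2) auto
      finally have L: "16 * L \<le> real (K + 1) powr \<alpha>" .
      have "exp (- L\<^sup>2 / 2) = exp (- ln T) * exp (- ln T)"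
        using ln by (simp add: L_def power_mult_distrib flip: exp_add)
      then have eq: "2 * real T * exp (- L\<^sup>2 / 2) = 2 / real T"
        using elim by (simp add: exp_minus field_simps)
      \<comment> \<open>From \<open>T \<ge> 4\<close>; this is the source of the factor
        \<open>1 / 2\<close> in the claimed bound.\<close>
      have half: "1 / 2 \<le> 1 - 2 * real T * exp (- L\<^sup>2 / 2)"
        unfolding eq using elim by (simp add: field_simps)
      have "real T powr (- \<eta> T) = exp (real K * ln q)"
        using ln elim by (simp add: powr_def \<eta>_def K_def)
      also have "\<dots> = q ^ K"
        using q by (simp add: exp_of_nat_mult)
      finally have "real T powr (- \<eta> T) / 2 \<le> q ^ K * (1 - 2 * real T * exp (- L\<^sup>2 / 2))"
        using mult_left_mono[OF half, of "q ^ K"] q by simp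
      also have "\<dots> \<le> prob {\<omega> \<in> space ?P. \<forall>t\<in>{1..T}. qcare_arm 2 \<alpha> \<omega> t = (if t \<le> K then 1 else 2)}"
        by (rule trap) (use \<alpha> K L elim ln in \<open>auto simp: K_def L_def\<close>)
      also have "\<dots> \<le> prob {\<omega> \<in> space ?P. ?S T \<omega> \<ge> 1 / 8 * real T}"
      proof (rule finite_measure_mono)
        show "{\<omega> \<in> space ?P. ?S T \<omega> \<ge> 1 / 8 * real T} \<in> events"
          using borel_measurable_integrable[OF integrable_gaps[OF bandit_instance_hard_instance], of \<alpha> T]
          by measurable
        show "{\<omega> \<in> space ?P. \<forall>t\<in>{1..T}. qcare_arm 2 \<alpha> \<omega> t = (if t \<le> K then 1 else 2)}
            \<subseteq> {\<omega> \<in> space ?P. ?S T \<omega> \<ge> 1 / 8 * real T}"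
        proof safe
          fix \<omega> assume arm: "\<forall>t\<in>{1..T}. qcare_arm 2 \<alpha> \<omega> t = (if t \<le> K then 1 else 2)"
          have "{1..T} \<inter> - {t. t \<le> K} = {K<..T}"
            by auto
          then have "(\<Sum>t = 1..T. if t \<le> K then 0 else 1 / 4 :: real) = real (T - K) / 4"
            by (subst sum.If_cases) simp_all
          moreover have "?S T \<omega> = (\<Sum>t = 1..T. if t \<le> K then 0 else 1 / 4)"
            using arm by (intro sum.cong) (auto simp: best_mean_hard_instance arm_mean_hard_instance)
          moreover have "2 * K \<le> T"
            using elim by (simp add: K_def)
          \<comment> \<open>Arm 2 is played in \<open>T - K \<ge> T / 2\<close> rounds, each with
            gap \<open>1 / 4\<close>; hence the constant \<open>1 / 8\<close>.\<close>
          ultimately show "?S T \<omega> \<ge> 1 / 8 * real T"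
            by simp
        qed
      qed
      finally show ?case .
    qed
  qed
qed

theorem theorem3:
  fixes \<alpha> :: real
  assumes "\<alpha> > 1 / 2"
  shows "(\<exists>\<Theta>. bandit_instance 2 \<Theta> \<and>
            (\<exists>c>0. Omega_T_minus_o1 (\<lambda>T.
               measure (bandit_space 2 \<Theta>)
                 {\<omega> \<in> space (bandit_space 2 \<Theta>).
                    (\<Sum>t = 1..T. best_mean 2 \<Theta> - arm_mean \<Theta> (qcare_arm 2 \<alpha> \<omega> t)) \<ge> c * real T})))
         \<and> (\<forall>\<epsilon>>0. asymp_Omega (worst_regret 2 \<alpha>) (\<lambda>T. real T powr (1 - \<epsilon>)))"
proof -
  define Pr where "Pr = (\<lambda>T. measure (bandit_space 2 hard_instance)
         {\<omega> \<in> space (bandit_space 2 hard_instance).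
           (\<Sum>t = 1..T. best_mean 2 hard_instance - arm_mean hard_instance (qcare_arm 2 \<alpha> \<omega> t)) \<ge> 1 / 8 * real T})"
  obtain \<eta> where \<eta>: "\<eta> \<longlonglongrightarrow> 0" and Pr: "\<forall>\<^sub>F T in sequentially. real T powr (- \<eta> T) / 2 \<le> Pr T"
    using linear_gaps_probability[OF assms] unfolding Pr_def by blast
  have "asymp_Omega Pr (\<lambda>T. real T powr (- \<eta> T))"
  proof (rule asymp_OmegaI)
    show "\<forall>\<^sub>F T in sequentially. 1 / 2 \<le> Pr T / real T powr (- \<eta> T)"
      using Pr eventually_gt_at_top[of 0] by eventually_elim (simp add: pos_le_divide_eq)
  qed simp
  then have Pr_Omega: "Omega_T_minus_o1 Pr"
    using \<eta> unfolding Omega_T_minus_o1_def by blast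
  have worst: "asymp_Omega (worst_regret 2 \<alpha>) (\<lambda>T. real T powr (1 - \<epsilon>))" if "\<epsilon> > 0" for \<epsilon>
  proof (rule asymp_OmegaI)
    have "\<forall>\<^sub>F T in sequentially. \<eta> T < \<epsilon>"
      using order_tendstoD(2)[OF \<eta> that] .
    then show "\<forall>\<^sub>F T in sequentially. 1 / 16 \<le> worst_regret 2 \<alpha> T / real T powr (1 - \<epsilon>)"
      using Pr eventually_gt_at_top[of 0]
    proof eventually_elim
      case (elim T)
      \<comment> \<open>Eventually \<open>\<eta> T < \<epsilon>\<close>, so the trap probability is
        at least \<open>T powr (- \<epsilon>) / 2\<close>. Multiplied by the threshold
        \<open>T / 8\<close> this yields the constant \<open>1 / 16\<close>.\<close>
      have "real T powr (- \<epsilon>) \<le> real T powr (- \<eta> T)"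
        using elim by (intro powr_mono) auto
      then have "1 / 16 * (real T * real T powr (- \<epsilon>)) \<le> 1 / 8 * real T * Pr T"
        using elim mult_left_mono[of "real T powr (- \<epsilon>) / 2" "Pr T" "1 / 8 * real T"] by simp
      also have "\<dots> \<le> regret 2 \<alpha> hard_instance T"
        unfolding Pr_def using elim by (intro regret_ge bandit_instance_hard_instance) auto
      \<comment> \<open>The same instance serves every \<open>T\<close>;
        \<open>bdd_above_regret\<close> ensures that the real-valued supremum dominates its
        regret.\<close>
      also have "\<dots> \<le> worst_regret 2 \<alpha> T"
        unfolding worst_regret_def
        by (rule cSUP_upper) (use bandit_instance_hard_instance bdd_above_regret in auto)
      also have "real T * real T powr (- \<epsilon>) = real T powr (1 - \<epsilon>)"
        using powr_add[of "real T" 1 "- \<epsilon>"] elim by simp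
      finally show ?case
        using elim by (simp add: pos_le_divide_eq)
    qed
  qed simp
  show ?thesis
  proof (rule conjI)
    have "(0::real) < 1 / 8"
      by simp
    with bandit_instance_hard_instance Pr_Omega[unfolded Pr_def]
    show "\<exists>\<Theta>. bandit_instance 2 \<Theta> \<and>
            (\<exists>c>0. Omega_T_minus_o1 (\<lambda>T.
               measure (bandit_space 2 \<Theta>)
                 {\<omega> \<in> space (bandit_space 2 \<Theta>).
                    (\<Sum>t = 1..T. best_mean 2 \<Theta> - arm_mean \<Theta> (qcare_arm 2 \<alpha> \<omega> t)) \<ge> c * real T}))"
      by blast
  qed (use worst in blast)
qed

end
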